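(* Let $D\ge 1$ be a real number for which sliding occurs. Then $$S(D)>\frac{\sqrt{3}}{2}D^2+\frac{D}{2\sqrt{3}}-1.$$
   Context: For a real number $D>0$, let $\mathcal{T}(D)$ be the set of all (non-degenerate) triangles with vertices in $\mathbb{Z}^2$, all side lengths at least $D$, and all angles at most $\pi/2$. Let $S(D)$ denote twice the smallest area of a triangle in $\mathcal{T}(D)$. Triangles in $\mathcal{T}(D)$ of minimal area are called M-triangles. We say that sliding occurs for $D$ if there exist two (distinct) M-triangles $OWA$ and $OWB$ sharing the two vertices $O,W$, with $A\neq B$ lying on the same side of the line $OW$. *)

theory Defs
  imports "HOL-Analysis.Analysis"
begin

definition integer_points :: "(real^2) set" where
  "integer_points = {P. \<forall>i. P $ i \<in> \<int>}"

(* The angle at Q. It is only used when P, Q, R are pairwise distinct. *)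
definition angle_at :: "real^2 \<Rightarrow> real^2 \<Rightarrow> real^2 \<Rightarrow> real" where
  "angle_at P Q R = arccos (((P - Q) \<bullet> (R - Q)) / (norm (P - Q) * norm (R - Q)))"

(* A triangle is represented by its set of three vertices. *)
definition is_triangle :: "(real^2) set \<Rightarrow> bool" where
  "is_triangle T \<longleftrightarrow> card T = 3 \<and> \<not> collinear T"

definition triangle_area :: "(real^2) set \<Rightarrow> real" where
  "triangle_area T = measure lborel (convex hull T)"

(* Since card T = 3, the equation T = {P, Q, R} ranges over all orderings of the
   vertices, so the last conjunct covers every side and every angle of T. *)
definition lattice_triangles :: "real \<Rightarrow> (real^2) set set" where
  "lattice_triangles D =
    {T. is_triangle T \<and> T \<subseteq> integer_points \<and>
        (\<forall>P Q R. T = {P, Q, R} \<longrightarrow> dist P Q \<ge> D \<and> angle_at P Q R \<le> pi / 2)}"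

definition S :: "real \<Rightarrow> real" where
  "S D = 2 * (LEAST a. a \<in> triangle_area ` lattice_triangles D)"

definition M_triangles :: "real \<Rightarrow> (real^2) set set" where
  "M_triangles D =
    {T \<in> lattice_triangles D. \<forall>T' \<in> lattice_triangles D. triangle_area T \<le> triangle_area T'}"

definition same_side :: "real^2 \<Rightarrow> real^2 \<Rightarrow> real^2 \<Rightarrow> real^2 \<Rightarrow> bool" where
  "same_side P Q A B \<longleftrightarrow> closed_segment A B \<inter> affine hull {P, Q} = {}"

(* Membership in M_triangles forces Q, W, A and Q, W, B to be pairwise distinct. *)
definition sliding :: "real \<Rightarrow> bool" where
  "sliding D \<longleftrightarrow>
    (\<exists>Q W A B. {Q, W, A} \<in> M_triangles D \<and> {Q, W, B} \<in> M_triangles D \<and>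
       A \<noteq> B \<and> same_side Q W A B)"

end

theory Submission
  imports Defs
begin

text \<open>
  The bound needs little more than the fact that distinct lattice points are at distance at
  least 1. Let \<open>L = |QW|\<close> be the length of the common base of the two M-triangles, and let \<open>H\<close>
  be their common height. Both have the least area and their apexes lie on the same side of \<open>QW\<close>,
  so \<open>A\<close> and \<open>B\<close> lie on a line parallel to \<open>QW\<close>, at distance at least 1 from each other
  (\<open>abs_inner_ge_norm_if_parallel\<close>). The angles at \<open>Q\<close> and \<open>W\<close> are not obtuse, so the feet of
  the two altitudes lie on the segment \<open>QW\<close>, at distance at least 1 from each other; hence one
  foot is at distance \<open>x \<le> (L - 1) / 2\<close> from an endpoint of the base. From this endpoint to the
  corresponding apex there is a side of length at least \<open>D\<close>, so \<open>H\<^sup>2 \<ge> D\<^sup>2 - (L - 1)\<^sup>2 / 4\<close>, and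
  twice the area, \<open>L * H\<close>, satisfies
  \[ (L H)^2 \ge L^2 (D^2 - (L - 1)^2 / 4). \]
  For \<open>D \<le> L \<le> sqrt 2 * D\<close> the right-hand side is smallest at \<open>L = D\<close>, where it is
  \<open>D\<^sup>2 * (3 * D\<^sup>2 + 2 * D - 1) / 4\<close>; the square root of this is
  \<open>sqrt 3 / 2 * D\<^sup>2 + D / (2 * sqrt 3)\<close> up to a bounded error, which the term \<open>- 1\<close> covers.
  If \<open>L \<ge> sqrt 2 * D\<close>, the angle at the apex comes in: as it is not obtuse, \<open>L * H \<ge> D\<^sup>2\<close>, which
  is at least as large. The lemma \<open>area_bound_if_foot_off_centre\<close> combines the two cases.
\<close>

section \<open>Real inequalities\<close>

text \<open>
  After the factor \<open>sqrt 3 / 2\<close> is taken out, the target is \<open>D\<^sup>2 + D / 3 - 2 / sqrt 3\<close>, and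
  \<open>2 / sqrt 3 > 1\<close>; replacing this constant by 1 leaves a comparison of polynomials.
\<close>

lemma target_less_if_square_ge:
  fixes D s :: real
  assumes "D \<ge> 1" and "s \<ge> 0" and "s\<^sup>2 \<ge> D\<^sup>2 * (3 * D\<^sup>2 + 2 * D - 1) / 4"
  shows "sqrt 3 / 2 * D\<^sup>2 + D / (2 * sqrt 3) - 1 < s"
proof -
  define q where "q = D\<^sup>2 + D / 3 - 1"
  have sqrt_less: "sqrt 3 < 2"
    by (simp add: real_less_lsqrt)
  have linear_term: "D / (2 * sqrt 3) = sqrt 3 / 2 * (D / 3)"
    by (simp add: field_simps)
  have target_less: "sqrt 3 / 2 * D\<^sup>2 + D / (2 * sqrt 3) - 1 < sqrt 3 / 2 * q"
    unfolding linear_term using sqrt_less by (simp add: q_def algebra_simps)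
  have "1 \<le> D\<^sup>2"
    using assms(1) by simp
  have "(sqrt 3 / 2 * q)\<^sup>2 = 3 / 4 * q\<^sup>2"
    by (simp add: power_mult_distrib power_divide)
  also have "\<dots> = D\<^sup>2 * (3 * D\<^sup>2 + 2 * D - 1) / 4 - (7 / 6 * D\<^sup>2 + D / 2 - 3 / 4)"
    by (simp add: q_def power2_eq_square field_simps)
  also have "\<dots> \<le> s\<^sup>2"
    using assms \<open>1 \<le> D\<^sup>2\<close> by linarith
  finally have "sqrt 3 / 2 * q \<le> s"
    using assms(2) by (rule power2_le_imp_le)
  with target_less show ?thesis
    by linarith
qed

text \<open>
  The difference of the two sides is \<open>L - D\<close> times
  \<open>(L + D) * D\<^sup>2 - (L + D - 1) * (L\<^sup>2 + D\<^sup>2 - L - D) / 4\<close>, and \<open>L\<^sup>2 + D\<^sup>2 \<le> 3 * D\<^sup>2\<close> makes this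
  second factor positive.
\<close>

lemma square_bound_least_at_base_eq_D:
  fixes D L :: real
  assumes "D \<ge> 1" and "L \<ge> D" and "L\<^sup>2 \<le> 2 * D\<^sup>2"
  shows "D\<^sup>2 * (3 * D\<^sup>2 + 2 * D - 1) / 4 \<le> L\<^sup>2 * (D\<^sup>2 - ((L - 1) / 2)\<^sup>2)"
proof -
  have "(L + D - 1) * (L\<^sup>2 + D\<^sup>2 - L - D) \<le> (L + D - 1) * (3 * D\<^sup>2)"
    using assms by (intro mult_left_mono) linarith+
  also have "\<dots> \<le> (L + D) * (4 * D\<^sup>2)"
    using assms by (intro mult_mono) auto
  finally have "0 \<le> (L - D) * ((L + D) * D\<^sup>2 - (L + D - 1) * (L\<^sup>2 + D\<^sup>2 - L - D) / 4)"
    using assms by (intro mult_nonneg_nonneg) auto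
  also have "\<dots> = L\<^sup>2 * (D\<^sup>2 - ((L - 1) / 2)\<^sup>2) - D\<^sup>2 * (3 * D\<^sup>2 + 2 * D - 1) / 4"
    by (simp add: power2_eq_square field_simps)
  finally show ?thesis
    by linarith
qed

text \<open>
  The side from the near endpoint gives the lower bound \<open>D\<^sup>2 - x\<^sup>2\<close> for \<open>H\<^sup>2\<close>, and the angle at the
  apex gives \<open>x * (L - x)\<close>. The former decreases and the latter increases with \<open>x \<le> L / 2\<close>; they
  meet at \<open>x = D\<^sup>2 / L\<close>.
\<close>

lemma twice_area_square_ge_if_long_base:
  fixes D L H x :: real
  assumes "D > 0" and "2 * D\<^sup>2 \<le> L\<^sup>2" and "L > 0"
    and "0 \<le> x" and "x \<le> L / 2"
    and side: "D\<^sup>2 \<le> x\<^sup>2 + H\<^sup>2" and apex_angle: "x * L \<le> x\<^sup>2 + H\<^sup>2"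
  shows "D\<^sup>2 * D\<^sup>2 \<le> (L * H)\<^sup>2"
proof -
  have scaled: "L\<^sup>2 * D\<^sup>2 \<le> (x * L)\<^sup>2 + (L * H)\<^sup>2"
    using mult_left_mono[OF side, of "L\<^sup>2"] by (simp add: power_mult_distrib algebra_simps)
  have base: "D\<^sup>2 * (2 * D\<^sup>2) \<le> D\<^sup>2 * L\<^sup>2"
    using assms(2) by (intro mult_left_mono) auto
  show ?thesis
  proof (cases "x * L \<le> D\<^sup>2")
    case True
    then have "(x * L)\<^sup>2 \<le> D\<^sup>2 * D\<^sup>2"
      using assms by (simp add: power2_eq_square mult_mono)
    with scaled base show ?thesis
      by (simp add: algebra_simps)
  next
    case False
    have "x * L \<le> L\<^sup>2 / 2"
      using mult_right_mono[OF \<open>x \<le> L / 2\<close>, of L] \<open>L > 0\<close> by (simp add: power2_eq_square)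
    then have "0 \<le> (x * L - D\<^sup>2) * (L\<^sup>2 - x * L - D\<^sup>2)"
      using False assms(2) by (intro mult_nonneg_nonneg) linarith+
    moreover have "x * L * L\<^sup>2 \<le> (x * L)\<^sup>2 + (L * H)\<^sup>2"
      using mult_left_mono[OF apex_angle, of "L\<^sup>2"] by (simp add: power_mult_distrib algebra_simps)
    ultimately show ?thesis
      using base by (simp add: power2_eq_square algebra_simps)
  qed
qed

text \<open>
  In this lemma \<open>L\<close> is the base of a triangle, \<open>H\<close> its height, and \<open>x\<close> the distance of the foot of
  the altitude from one endpoint of the base. Being off-centre by at least \<open>1 / 2\<close> is what
  improves on the bound \<open>sqrt 3 / 2 * D\<^sup>2\<close>, which holds for all triangles with sides at least \<open>D\<close>
  and without obtuse angles.
\<close>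

lemma area_bound_if_foot_off_centre:
  fixes D L H x :: real
  assumes "D \<ge> 1" and "L \<ge> D" and "H \<ge> 0"
    and "0 \<le> x" and "x \<le> (L - 1) / 2"
    and side: "D\<^sup>2 \<le> x\<^sup>2 + H\<^sup>2" and apex_angle: "x * L \<le> x\<^sup>2 + H\<^sup>2"
  shows "sqrt 3 / 2 * D\<^sup>2 + D / (2 * sqrt 3) - 1 < L * H"
proof (rule target_less_if_square_ge)
  show "D \<ge> 1" and "L * H \<ge> 0"
    using assms by auto
  show "D\<^sup>2 * (3 * D\<^sup>2 + 2 * D - 1) / 4 \<le> (L * H)\<^sup>2"
  proof (cases "L\<^sup>2 \<le> 2 * D\<^sup>2")
    case True
    have "x\<^sup>2 \<le> ((L - 1) / 2)\<^sup>2"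
      using assms by (intro power_mono) auto
    then have "L\<^sup>2 * (D\<^sup>2 - ((L - 1) / 2)\<^sup>2) \<le> L\<^sup>2 * H\<^sup>2"
      using side by (intro mult_left_mono) auto
    with square_bound_least_at_base_eq_D[OF assms(1,2) True] show ?thesis
      by (simp add: power_mult_distrib)
  next
    case False
    have "D\<^sup>2 * D\<^sup>2 \<le> (L * H)\<^sup>2"
      using False assms by (intro twice_area_square_ge_if_long_base[of D L x H]) auto
    moreover have "D\<^sup>2 * (3 * D\<^sup>2 + 2 * D - 1) \<le> D\<^sup>2 * (4 * D\<^sup>2)"
    proof (intro mult_left_mono)
      have "0 \<le> (D - 1)\<^sup>2"
        by simp
      then show "3 * D\<^sup>2 + 2 * D - 1 \<le> 4 * D\<^sup>2"
        by (simp add: power2_eq_square algebra_simps)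
    qed simp
    ultimately show ?thesis
      by (simp add: algebra_simps)
  qed
qed

section \<open>Plane vectors\<close>

definition cross2 :: "real^2 \<Rightarrow> real^2 \<Rightarrow> real" where
  "cross2 u v = u $ 1 * v $ 2 - u $ 2 * v $ 1"

lemma inner_cross2_identity:
  "(norm u)\<^sup>2 * (norm v)\<^sup>2 = (u \<bullet> v)\<^sup>2 + (cross2 u v)\<^sup>2" for u v :: "real^2"
  unfolding power2_norm_eq_inner
  by (simp add: inner_vec_def sum_2 cross2_def power2_eq_square algebra_simps)

lemma triangle_area_eq_cross2:
  "2 * triangle_area {P, Q, R} = \<bar>cross2 (Q - P) (R - P)\<bar>"
  unfolding triangle_area_def cross2_def
  by (simp add: content_triangle algebra_simps abs_minus_commute)

lemma one_le_norm_diff_if_integer_points: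
  assumes "P \<in> integer_points" and "Q \<in> integer_points" and "P \<noteq> Q"
  shows "1 \<le> norm (P - Q)"
proof -
  obtain i where "P $ i \<noteq> Q $ i"
    using assms(3) by (auto simp: vec_eq_iff)
  moreover have "P $ i - Q $ i \<in> \<int>"
    using assms by (auto simp: integer_points_def)
  ultimately have "1 \<le> \<bar>(P - Q) $ i\<bar>"
    by (simp add: Ints_nonzero_abs_ge1)
  then show ?thesis
    using component_le_norm_cart[of "P - Q" i] by linarith
qed

lemma inner_nonneg_if_angle_le:
  assumes "angle_at P Q R \<le> pi / 2"
  shows "0 \<le> (P - Q) \<bullet> (R - Q)"
proof (rule ccontr)
  define c where "c = (P - Q) \<bullet> (R - Q) / (norm (P - Q) * norm (R - Q))"
  assume obtuse: "\<not> 0 \<le> (P - Q) \<bullet> (R - Q)"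
  then have "P - Q \<noteq> 0" and "R - Q \<noteq> 0"
    by auto
  then have pos: "0 < norm (P - Q) * norm (R - Q)"
    by simp
  have "\<bar>c\<bar> \<le> 1"
    using Cauchy_Schwarz_ineq2[of "P - Q" "R - Q"] pos
    by (simp add: c_def abs_divide abs_mult)
  moreover have "c < 0"
    using obtuse pos by (simp add: c_def divide_neg_pos)
  ultimately have "arccos 0 < arccos c"
    by (intro arccos_less_arccos) auto
  with assms show False
    by (simp add: angle_at_def c_def)
qed

lemma abs_inner_ge_norm_if_parallel:
  fixes p d :: "real^2"
  assumes "cross2 p d = 0" and "1 \<le> norm d"
  shows "norm p \<le> \<bar>p \<bullet> d\<bar>"
proof -
  have "\<bar>p \<bullet> d\<bar>\<^sup>2 = (norm p * norm d)\<^sup>2"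
    using inner_cross2_identity[of p d] assms(1) by (simp add: power_mult_distrib)
  then have "\<bar>p \<bullet> d\<bar> = norm p * norm d"
    by (metis abs_ge_zero mult_nonneg_nonneg norm_ge_zero power2_eq_iff_nonneg)
  then show ?thesis
    using mult_left_mono[OF assms(2) norm_ge_zero[of p]] by simp
qed

text \<open>
  The triangle has vertices \<open>0\<close>, \<open>p\<close> and \<open>a\<close>; \<open>x = (p \<bullet> a) / L\<close> is the distance from \<open>0\<close> to the
  foot of the altitude from \<open>a\<close>.
\<close>

lemma cross2_bound_if_foot_off_centre:
  fixes p a :: "real^2"
  assumes "D \<ge> 1" and "D \<le> norm p" and "D \<le> norm a"
    and "0 \<le> p \<bullet> a" and "0 \<le> a \<bullet> (a - p)"
    and near: "2 * (p \<bullet> a) \<le> norm p * (norm p - 1)"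
  shows "sqrt 3 / 2 * D\<^sup>2 + D / (2 * sqrt 3) - 1 < \<bar>cross2 p a\<bar>"
proof -
  define L where "L = norm p"
  define x where "x = (p \<bullet> a) / L"
  define H where "H = \<bar>cross2 p a\<bar> / L"
  have "L > 0"
    using assms(1,2) unfolding L_def by linarith
  then have xL: "x * L = p \<bullet> a" and LH: "L * H = \<bar>cross2 p a\<bar>"
    by (simp_all add: x_def H_def)
  have "L\<^sup>2 * (x\<^sup>2 + H\<^sup>2) = (x * L)\<^sup>2 + (L * H)\<^sup>2"
    by (simp add: power_mult_distrib algebra_simps)
  also have "\<dots> = L\<^sup>2 * (norm a)\<^sup>2"
    unfolding xL LH using inner_cross2_identity[of p a] by (simp add: L_def)
  finally have pythagoras: "x\<^sup>2 + H\<^sup>2 = (norm a)\<^sup>2"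
    using \<open>L > 0\<close> by simp
  have "sqrt 3 / 2 * D\<^sup>2 + D / (2 * sqrt 3) - 1 < L * H"
  proof (rule area_bound_if_foot_off_centre)
    show "D \<ge> 1" and "L \<ge> D"
      using assms by (simp_all add: L_def)
    show "H \<ge> 0" and "0 \<le> x"
      using \<open>L > 0\<close> assms(4) by (simp_all add: H_def x_def)
    have "L * (2 * x) \<le> L * (L - 1)"
      using near xL by (simp add: L_def algebra_simps)
    then show "x \<le> (L - 1) / 2"
      using \<open>L > 0\<close> by simp
    show "D\<^sup>2 \<le> x\<^sup>2 + H\<^sup>2"
      using assms by (simp add: pythagoras power_mono)
    show "x * L \<le> x\<^sup>2 + H\<^sup>2"
      using assms(5) by (simp add: pythagoras xL power2_norm_eq_inner inner_diff_right inner_commute)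
  qed
  then show ?thesis
    by (simp add: LH)
qed

lemma mem_affine_hull_if_cross2_eq_0:
  fixes P Q X :: "real^2"
  assumes "P \<noteq> Q" and "cross2 (Q - P) (X - P) = 0"
  shows "X \<in> affine hull {P, Q}"
proof -
  define p where "p = Q - P"
  define t where "t = (p \<bullet> (X - P)) / (p \<bullet> p)"
  have "p \<bullet> p \<noteq> 0"
    using assms(1) by (simp add: p_def)
  moreover have "(p \<bullet> p) *\<^sub>R (X - P) = (p \<bullet> (X - P)) *\<^sub>R p"
    using assms(2)
    by (simp add: vec_eq_iff forall_2 inner_vec_def sum_2 cross2_def p_def) algebra
  ultimately have "X - P = t *\<^sub>R p"
    unfolding t_def by (metis divide_inverse_commute scaleR_one scaleR_scaleR left_inverse)
  then have "X = (1 - t) *\<^sub>R P + t *\<^sub>R Q"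
    by (simp add: p_def algebra_simps)
  then show ?thesis
    unfolding affine_hull_2 by (intro CollectI exI[of _ "1 - t"] exI[of _ t] conjI) simp_all
qed

text \<open>
  If the two signed areas were opposite, the midpoint of \<open>A\<close> and \<open>B\<close> would lie on the line through
  \<open>P\<close> and \<open>Q\<close>.
\<close>

lemma cross2_eq_if_same_side:
  assumes "P \<noteq> Q" and "same_side P Q A B"
    and "\<bar>cross2 (Q - P) (A - P)\<bar> = \<bar>cross2 (Q - P) (B - P)\<bar>"
  shows "cross2 (Q - P) (A - P) = cross2 (Q - P) (B - P)"
proof (rule ccontr)
  assume "cross2 (Q - P) (A - P) \<noteq> cross2 (Q - P) (B - P)"
  with assms(3) have "cross2 (Q - P) (A - P) + cross2 (Q - P) (B - P) = 0"
    by linarith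
  then have "cross2 (Q - P) (midpoint A B - P) = 0"
    by (simp add: cross2_def midpoint_def field_simps)
  then have "midpoint A B \<in> affine hull {P, Q}"
    by (rule mem_affine_hull_if_cross2_eq_0[OF assms(1)])
  then show False
    using assms(2) midpoint_in_closed_segment[of A B] unfolding same_side_def by blast
qed

section \<open>Sliding\<close>

lemma lattice_trianglesD:
  assumes "{P, Q, R} \<in> lattice_triangles D"
  shows "P \<noteq> Q" and "R \<in> integer_points"
    and "D \<le> norm (Q - P)" and "D \<le> norm (R - P)"
    and "0 \<le> (Q - P) \<bullet> (R - P)" and "0 \<le> (R - P) \<bullet> (R - Q)"
proof -
  have sides_angles: "D \<le> dist X Y \<and> angle_at X Y Z \<le> pi / 2" if "{P, Q, R} = {X, Y, Z}" for X Y Z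
    using assms that by (auto simp: lattice_triangles_def)
  have "card {P, Q, R} = 3"
    using assms by (simp add: lattice_triangles_def is_triangle_def)
  then show "P \<noteq> Q"
    by (auto simp: card_insert_if split: if_splits)
  show "R \<in> integer_points"
    using assms by (simp add: lattice_triangles_def)
  have "{P, Q, R} = {Q, P, R}" and "{P, Q, R} = {R, P, Q}" and "{P, Q, R} = {P, R, Q}"
    by auto
  note perms = this[THEN sides_angles]
  show "D \<le> norm (Q - P)" and "D \<le> norm (R - P)"
    using perms by (simp_all add: dist_norm)
  show "0 \<le> (Q - P) \<bullet> (R - P)"
    using perms inner_nonneg_if_angle_le[of Q P R] by simp
  show "0 \<le> (R - P) \<bullet> (R - Q)"
    using perms inner_nonneg_if_angle_le[of P R Q]
    by (simp add: inner_diff_left inner_diff_right)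
qed

lemma S_eq_twice_area:
  assumes "T \<in> M_triangles D"
  shows "S D = 2 * triangle_area T"
proof -
  have "(LEAST a. a \<in> triangle_area ` lattice_triangles D) = triangle_area T"
    using assms by (intro Least_equality) (auto simp: M_triangles_def)
  then show ?thesis
    by (simp add: S_def)
qed

text \<open>
  Here the foot of the altitude from \<open>B\<close> lies at least 1 further along the base than that from
  \<open>A\<close>. So the former is closer to \<open>W\<close>, or the latter closer to \<open>Q\<close>, than the centre by at least
  \<open>1 / 2\<close>.
\<close>

lemma area_bound_if_feet_far_apart:
  assumes "D \<ge> 1"
    and A: "{Q, W, A} \<in> lattice_triangles D" and B: "{Q, W, B} \<in> lattice_triangles D"
    and cross2_eq: "cross2 (W - Q) (A - Q) = cross2 (W - Q) (B - Q)"
    and feet: "norm (W - Q) \<le> (W - Q) \<bullet> (B - A)"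
  shows "sqrt 3 / 2 * D\<^sup>2 + D / (2 * sqrt 3) - 1 < \<bar>cross2 (W - Q) (A - Q)\<bar>"
proof (cases "2 * ((W - Q) \<bullet> (A - Q)) \<le> norm (W - Q) * (norm (W - Q) - 1)")
  case True
  show ?thesis
    using lattice_trianglesD[OF A] True \<open>D \<ge> 1\<close>
    by (intro cross2_bound_if_foot_off_centre) auto
next
  case False
  have "{W, Q, B} \<in> lattice_triangles D"
    using B by (simp add: insert_commute)
  note B' = lattice_trianglesD[OF this]
  have "(Q - W) \<bullet> (B - W) = (norm (W - Q))\<^sup>2 - (W - Q) \<bullet> (A - Q) - (W - Q) \<bullet> (B - A)"
    unfolding power2_norm_eq_inner by (simp add: inner_diff_left inner_diff_right inner_commute)
  then have "2 * ((Q - W) \<bullet> (B - W)) \<le> norm (Q - W) * (norm (Q - W) - 1)"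
    using False feet by (simp add: norm_minus_commute[of Q W] power2_eq_square algebra_simps)
  then have "sqrt 3 / 2 * D\<^sup>2 + D / (2 * sqrt 3) - 1 < \<bar>cross2 (Q - W) (B - W)\<bar>"
    using B' \<open>D \<ge> 1\<close> by (intro cross2_bound_if_foot_off_centre) auto
  also have "cross2 (Q - W) (B - W) = - cross2 (W - Q) (B - Q)"
    by (simp add: cross2_def algebra_simps)
  finally show ?thesis
    by (simp add: cross2_eq)
qed

theorem theorem3:
  fixes D :: real
  assumes "D \<ge> 1" and "sliding D"
  shows "S D > sqrt 3 / 2 * D\<^sup>2 + D / (2 * sqrt 3) - 1"
proof -
  obtain Q W A B where M: "{Q, W, A} \<in> M_triangles D" "{Q, W, B} \<in> M_triangles D"
    and "A \<noteq> B" and same: "same_side Q W A B"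
    using assms(2) by (auto simp: sliding_def)
  then have A: "{Q, W, A} \<in> lattice_triangles D" and B: "{Q, W, B} \<in> lattice_triangles D"
    by (auto simp: M_triangles_def)
  have S_A: "S D = \<bar>cross2 (W - Q) (A - Q)\<bar>" and S_B: "S D = \<bar>cross2 (W - Q) (B - Q)\<bar>"
    using M[THEN S_eq_twice_area] by (simp_all add: triangle_area_eq_cross2)
  have cross2_eq: "cross2 (W - Q) (A - Q) = cross2 (W - Q) (B - Q)"
    using lattice_trianglesD(1)[OF A] same S_A S_B by (intro cross2_eq_if_same_side) auto
  have "cross2 (W - Q) (B - A) = cross2 (W - Q) (B - Q) - cross2 (W - Q) (A - Q)"
    by (simp add: cross2_def algebra_simps)
  then have "cross2 (W - Q) (B - A) = 0"
    using cross2_eq by simp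
  moreover have "1 \<le> norm (B - A)"
    using lattice_trianglesD(2)[OF A] lattice_trianglesD(2)[OF B] \<open>A \<noteq> B\<close>
    by (intro one_le_norm_diff_if_integer_points) auto
  ultimately have "norm (W - Q) \<le> \<bar>(W - Q) \<bullet> (B - A)\<bar>"
    by (rule abs_inner_ge_norm_if_parallel)
  then consider "norm (W - Q) \<le> (W - Q) \<bullet> (B - A)" | "norm (W - Q) \<le> (W - Q) \<bullet> (A - B)"
    by (auto simp: abs_if inner_diff_right split: if_splits)
  then show ?thesis
  proof cases
    case 1
    then show ?thesis
      using area_bound_if_feet_far_apart[OF assms(1) A B cross2_eq] S_A by simp
  next
    case 2
    then show ?thesis
      using area_bound_if_feet_far_apart[OF assms(1) B A cross2_eq[symmetric]] S_B by simp
  qed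
qed

end
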